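(* Let $(M^{2n+s},\phi,\xi_i,\eta_j,g)$ be an $\mathcal{S}$-manifold of CR-codimension $s\ge1$, endowed with its unique almost metric $\phi$-connection $\nabla$ with (parallel) skew-torsion $T$, that is, $T=2\bar\eta\wedge F$ where $\bar\eta=\sum_{i=1}^{s}\eta_i$. Then no non-zero horizontal vector $U\in\mathcal{D}_x$ lies in the kernel $\ker(T_x)$ of $T_x$, at any $x\in M$. Moreover, $\ker(T_x)$ coincides with the orthogonal complement of the vertical vector $\bar\xi_x=\sum_{j=1}^{s}\xi_j(x)$ in $\mathcal{D}^{\perp}_x=\langle\xi_1(x),\dots,\xi_s(x)\rangle$, and in particular there is an isomorphism $\ker(T_x)\cong\mathbb{R}^{s-1}$ at any $x\in M$. Therefore the corresponding distribution $\ker(T)$ is a smooth subbundle of $\mathcal{D}^{\perp}$ of rank $s-1$.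
   Context: Manifolds are smooth and connected. A metric $f$-manifold $(M^{2n+s},\phi,\xi_i,\eta_j,g)$ is a $(2n+s)$-dimensional manifold $M$ with a $(1,1)$-tensor field $\phi$ of constant rank $2n$ satisfying $\phi^3+\phi=0$, global vector fields $\xi_1,\dots,\xi_s$ and 1-forms $\eta_1,\dots,\eta_s$ with $\ker\phi=\langle\xi_1,\dots,\xi_s\rangle$, $\eta_i(\xi_j)=\delta_{ij}$, $\eta_i\circ\phi=0$, $\phi^2=-\mathrm{Id}+\sum_i\eta_i\otimes\xi_i$, and a Riemannian metric $g$ with $g(\phi X,\phi Y)=g(X,Y)-\sum_i\eta_i(X)\eta_i(Y)$. The number $s$ is the CR-codimension. Put $\mathcal{D}=\mathrm{Im}(\phi)$ (horizontal distribution) and $\mathcal{D}^{\perp}=\ker\phi$ (vertical distribution); $TM=\mathcal{D}\oplus\mathcal{D}^\perp$ is $g$-orthogonal. The fundamental 2-form is $F(X,Y)=g(X,\phi Y)$. Convention: $d\eta(X,Y)=X\eta(Y)-Y\eta(X)-\eta([X,Y])$. The Nijenhuis tensor is $N^{(1)}=N_\phi+\sum_i d\eta_i\otimes\xi_i$ with $N_\phi(X,Y)=[\phi X,\phi Y]+\phi^2[X,Y]-\phi[X,\phi Y]-\phi[\phi X,Y]$. An $\mathcal{S}$-manifold is a metric $f$-manifold with $N^{(1)}=0$ and $2F=d\eta_i$ for all $i=1,\dots,s$. An affine connection is an almost metric $\phi$-connection if it makes $g,\phi,\xi_i,\eta_i$ (all $i$) parallel; it has skew-torsion if $T(X,Y,Z)=g(T(X,Y),Z)$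 is a 3-form. Every $\mathcal{S}$-manifold admits a unique such connection with skew-torsion, whose torsion is $T=2\bar\eta\wedge F$. The kernel of the 3-form at $x$ is $\ker(T_x)=\{U\in T_xM: U\lrcorner T_x=0\}$, and $\ker(T)=\bigsqcup_x\ker(T_x)$.
   Formalization: The formal statement assumes n ≥ 1 (φ of positive rank); for n = 0 one has F = 0 and T = 0, so ker(T) is all of the vertical distribution, of rank s rather than s−1, and the claim fails. *)

theory Defs
  imports "HOL-Analysis.Analysis" "HOL-Library.Function_Algebras"
begin

section \<open>Linear algebra\<close>

text \<open>Functions form a real vector space pointwise. Tangent vectors will be real-valued functionals,
  so this makes \<^const>\<open>span\<close>, \<^const>\<open>dim\<close> and \<^const>\<open>independent\<close> available for them.\<close>

instantiation "fun" :: (type, real_vector) real_vector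
begin

definition scaleR_fun :: "real \<Rightarrow> ('a \<Rightarrow> 'b) \<Rightarrow> 'a \<Rightarrow> 'b" where
  "scaleR_fun c f = (\<lambda>x. c *\<^sub>R f x)"

instance
  by standard (auto simp: scaleR_fun_def plus_fun_def fun_eq_iff scaleR_add_right scaleR_add_left)

end

definition linear_map_on :: "'v::real_vector set \<Rightarrow> ('v \<Rightarrow> 'w::real_vector) \<Rightarrow> bool" where
  "linear_map_on V L \<longleftrightarrow>
     (\<forall>u\<in>V. \<forall>v\<in>V. L (u + v) = L u + L v) \<and> (\<forall>c. \<forall>u\<in>V. L (c *\<^sub>R u) = c *\<^sub>R L u)"

definition linear_isomorphic :: "'v::real_vector set \<Rightarrow> 'w::real_vector set \<Rightarrow> bool" where
  "linear_isomorphic V W \<longleftrightarrow>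
     subspace V \<and> subspace W \<and> (\<exists>L. linear_map_on V L \<and> bij_betw L V W)"

text \<open>The coordinate space of dimension \<open>k\<close>, for \<open>k\<close> a term rather than a type: real sequences
  supported on the indices below \<open>k\<close>.\<close>

definition Rn :: "nat \<Rightarrow> (nat \<Rightarrow> real) set" where
  "Rn k = {v. \<forall>i\<ge>k. v i = 0}"

text \<open>\<open>b 0, \<dots>, b (k - 1)\<close> is a basis of the linear subspace \<open>V\<close>.\<close>

definition is_basis :: "nat \<Rightarrow> (nat \<Rightarrow> 'v::real_vector) \<Rightarrow> 'v set \<Rightarrow> bool" where
  "is_basis k b V \<longleftrightarrow>
     inj_on b {..<k} \<and> independent (b ` {..<k}) \<and> span (b ` {..<k}) = V"


section \<open>Smooth manifolds\<close>

text \<open>Only used for open \<open>S\<close>. In finite dimension, being of class \<open>k + 1\<close> amounts to being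
  differentiable with all directional derivatives of class \<open>k\<close>.\<close>

primrec Ck_on :: "nat \<Rightarrow> 'e::euclidean_space set \<Rightarrow> ('e \<Rightarrow> 'b::real_normed_vector) \<Rightarrow> bool" where
  "Ck_on 0 S f \<longleftrightarrow> continuous_on S f"
| "Ck_on (Suc k) S f \<longleftrightarrow>
     (\<forall>x\<in>S. f differentiable (at x)) \<and> (\<forall>v. Ck_on k S (\<lambda>x. frechet_derivative f (at x) v))"

definition Cinf_on :: "'e::euclidean_space set \<Rightarrow> ('e \<Rightarrow> 'b::real_normed_vector) \<Rightarrow> bool" where
  "Cinf_on S f \<longleftrightarrow> (\<forall>k. Ck_on k S f)"

text \<open>A topological space with an atlas of charts \<open>(U, \<psi>)\<close>; a chart map \<open>\<psi>\<close> is meaningful on \<open>U\<close> only.\<close>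

record ('a, 'e) manifold =
  mtop :: "'a topology"
  atlas :: "('a set \<times> ('a \<Rightarrow> 'e)) set"

abbreviation pts :: "('a, 'e) manifold \<Rightarrow> 'a set" where
  "pts M \<equiv> topspace (mtop M)"

definition is_chart :: "'a topology \<Rightarrow> 'a set \<Rightarrow> ('a \<Rightarrow> 'e::euclidean_space) \<Rightarrow> bool" where
  "is_chart X U \<psi> \<longleftrightarrow> openin X U \<and> open (\<psi> ` U) \<and>
     homeomorphic_map (subtopology X U) (top_of_set (\<psi> ` U)) \<psi>"

definition smooth_manifold :: "('a, 'e::euclidean_space) manifold \<Rightarrow> bool" where
  "smooth_manifold M \<longleftrightarrow>
     Hausdorff_space (mtop M) \<and> second_countable (mtop M) \<and>
     (\<forall>(U, \<psi>)\<in>atlas M. is_chart (mtop M) U \<psi>) \<and>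
     (\<Union>(U, \<psi>)\<in>atlas M. U) = pts M \<and>
     (\<forall>(U, \<psi>)\<in>atlas M. \<forall>(V, \<theta>)\<in>atlas M. Cinf_on (\<psi> ` (U \<inter> V)) (\<theta> \<circ> inv_into U \<psi>))"

definition smooth_fun_on :: "('a, 'e::euclidean_space) manifold \<Rightarrow> 'a set \<Rightarrow> ('a \<Rightarrow> real) \<Rightarrow> bool" where
  "smooth_fun_on M W f \<longleftrightarrow> (\<forall>(U, \<psi>)\<in>atlas M. Cinf_on (\<psi> ` (U \<inter> W)) (f \<circ> inv_into U \<psi>))"

definition smooth_funs :: "('a, 'e::euclidean_space) manifold \<Rightarrow> ('a \<Rightarrow> real) set" where
  "smooth_funs M = {f. smooth_fun_on M (pts M) f}"

text \<open>Tangent vectors at \<open>p\<close> are the derivations at \<open>p\<close> of the algebra of smooth functions, extended by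
  zero to functions that are not smooth, so that each derivation is a unique element of the type.\<close>

type_synonym 'a tvec = "('a \<Rightarrow> real) \<Rightarrow> real"
type_synonym 'a field = "'a \<Rightarrow> 'a tvec"

definition tangent_space :: "('a, 'e::euclidean_space) manifold \<Rightarrow> 'a \<Rightarrow> 'a tvec set" where
  "tangent_space M p = {D.
     (\<forall>f. f \<notin> smooth_funs M \<longrightarrow> D f = 0) \<and>
     (\<forall>f\<in>smooth_funs M. \<forall>g\<in>smooth_funs M. D (\<lambda>q. f q + g q) = D f + D g) \<and>
     (\<forall>c. \<forall>f\<in>smooth_funs M. D (\<lambda>q. c * f q) = c * D f) \<and>
     (\<forall>f\<in>smooth_funs M. \<forall>g\<in>smooth_funs M. D (\<lambda>q. f q * g q) = D f * g p + f p * D g)}"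

definition vector_fields_on :: "('a, 'e::euclidean_space) manifold \<Rightarrow> 'a set \<Rightarrow> 'a field set" where
  "vector_fields_on M W = {X. (\<forall>p\<in>W. X p \<in> tangent_space M p) \<and>
     (\<forall>f\<in>smooth_funs M. smooth_fun_on M W (\<lambda>q. X q f))}"

abbreviation vector_fields :: "('a, 'e::euclidean_space) manifold \<Rightarrow> 'a field set" where
  "vector_fields M \<equiv> vector_fields_on M (pts M)"

definition lie_bracket :: "'a field \<Rightarrow> 'a field \<Rightarrow> 'a field" where
  "lie_bracket X Y = (\<lambda>p f. X p (\<lambda>q. Y q f) - Y p (\<lambda>q. X q f))"


section \<open>Tensor fields\<close>

text \<open>Tensor fields are families of multilinear maps on the tangent spaces; values on functionals that are
  not tangent vectors at the given point are irrelevant. Smoothness is tested on global smooth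
  vector fields.\<close>

definition one_form :: "('a, 'e::euclidean_space) manifold \<Rightarrow> ('a \<Rightarrow> 'a tvec \<Rightarrow> real) \<Rightarrow> bool" where
  "one_form M \<eta> \<longleftrightarrow> (\<forall>p\<in>pts M. linear_map_on (tangent_space M p) (\<eta> p)) \<and>
     (\<forall>X\<in>vector_fields M. (\<lambda>p. \<eta> p (X p)) \<in> smooth_funs M)"

definition tensor11 :: "('a, 'e::euclidean_space) manifold \<Rightarrow> ('a \<Rightarrow> 'a tvec \<Rightarrow> 'a tvec) \<Rightarrow> bool" where
  "tensor11 M \<phi> \<longleftrightarrow>
     (\<forall>p\<in>pts M. \<phi> p ` tangent_space M p \<subseteq> tangent_space M p \<and>
        linear_map_on (tangent_space M p) (\<phi> p)) \<and>
     (\<forall>X\<in>vector_fields M. (\<lambda>p. \<phi> p (X p)) \<in> vector_fields M)"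

definition riemannian_metric ::
    "('a, 'e::euclidean_space) manifold \<Rightarrow> ('a \<Rightarrow> 'a tvec \<Rightarrow> 'a tvec \<Rightarrow> real) \<Rightarrow> bool" where
  "riemannian_metric M g \<longleftrightarrow>
     (\<forall>p\<in>pts M.
        (\<forall>u\<in>tangent_space M p. linear_map_on (tangent_space M p) (g p u)) \<and>
        (\<forall>u\<in>tangent_space M p. \<forall>v\<in>tangent_space M p. g p u v = g p v u) \<and>
        (\<forall>u\<in>tangent_space M p. u \<noteq> 0 \<longrightarrow> g p u u > 0)) \<and>
     (\<forall>X\<in>vector_fields M. \<forall>Y\<in>vector_fields M. (\<lambda>p. g p (X p) (Y p)) \<in> smooth_funs M)"

text \<open>Given alternation in neighbouring slots, linearity in the last slot gives linearity in all three.\<close>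

definition three_form ::
    "('a, 'e::euclidean_space) manifold \<Rightarrow> ('a \<Rightarrow> 'a tvec \<Rightarrow> 'a tvec \<Rightarrow> 'a tvec \<Rightarrow> real) \<Rightarrow> bool" where
  "three_form M T \<longleftrightarrow>
     (\<forall>p\<in>pts M. \<forall>u\<in>tangent_space M p. \<forall>v\<in>tangent_space M p.
        linear_map_on (tangent_space M p) (T p u v) \<and>
        (\<forall>w\<in>tangent_space M p. T p u v w = - T p v u w \<and> T p u v w = - T p u w v)) \<and>
     (\<forall>X\<in>vector_fields M. \<forall>Y\<in>vector_fields M. \<forall>Z\<in>vector_fields M.
        (\<lambda>p. T p (X p) (Y p) (Z p)) \<in> smooth_funs M)"

text \<open>No factor 1/2, and the matching wedge product of a 1-form and a 2-form without numerical factor.\<close>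

definition ext_d :: "('a \<Rightarrow> 'a tvec \<Rightarrow> real) \<Rightarrow> 'a field \<Rightarrow> 'a field \<Rightarrow> 'a \<Rightarrow> real" where
  "ext_d \<eta> X Y p =
     X p (\<lambda>q. \<eta> q (Y q)) - Y p (\<lambda>q. \<eta> q (X q)) - \<eta> p (lie_bracket X Y p)"

definition wedge12 ::
    "('v \<Rightarrow> real) \<Rightarrow> ('v \<Rightarrow> 'v \<Rightarrow> real) \<Rightarrow> 'v \<Rightarrow> 'v \<Rightarrow> 'v \<Rightarrow> real" where
  "wedge12 \<alpha> \<omega> u v w = \<alpha> u * \<omega> v w + \<alpha> v * \<omega> w u + \<alpha> w * \<omega> u v"


section \<open>Metric f-manifolds and S-manifolds\<close>

definition metric_f_manifold ::
    "('a, 'e::euclidean_space) manifold \<Rightarrow> nat \<Rightarrow> nat \<Rightarrow> ('a \<Rightarrow> 'a tvec \<Rightarrow> 'a tvec) \<Rightarrow>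
     (nat \<Rightarrow> 'a field) \<Rightarrow> (nat \<Rightarrow> 'a \<Rightarrow> 'a tvec \<Rightarrow> real) \<Rightarrow>
     ('a \<Rightarrow> 'a tvec \<Rightarrow> 'a tvec \<Rightarrow> real) \<Rightarrow> bool" where
  "metric_f_manifold M n s \<phi> \<xi> \<eta> g \<longleftrightarrow>
     smooth_manifold M \<and> connected_space (mtop M) \<and> DIM('e) = 2 * n + s \<and>
     tensor11 M \<phi> \<and> riemannian_metric M g \<and>
     (\<forall>i\<in>{1..s}. \<xi> i \<in> vector_fields M \<and> one_form M (\<eta> i)) \<and>
     (\<forall>p\<in>pts M.
        dim (\<phi> p ` tangent_space M p) = 2 * n \<and>
        {u \<in> tangent_space M p. \<phi> p u = 0} = span ((\<lambda>i. \<xi> i p) ` {1..s}) \<and>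
        (\<forall>i\<in>{1..s}. \<forall>j\<in>{1..s}. \<eta> i p (\<xi> j p) = (if i = j then 1 else 0)) \<and>
        (\<forall>u\<in>tangent_space M p.
           \<phi> p (\<phi> p (\<phi> p u)) + \<phi> p u = 0 \<and>
           (\<forall>i\<in>{1..s}. \<eta> i p (\<phi> p u) = 0) \<and>
           \<phi> p (\<phi> p u) = - u + (\<Sum>i=1..s. \<eta> i p u *\<^sub>R \<xi> i p) \<and>
           (\<forall>v\<in>tangent_space M p.
              g p (\<phi> p u) (\<phi> p v) = g p u v - (\<Sum>i=1..s. \<eta> i p u * \<eta> i p v))))"

definition horizontal ::
    "('a, 'e::euclidean_space) manifold \<Rightarrow> ('a \<Rightarrow> 'a tvec \<Rightarrow> 'a tvec) \<Rightarrow> 'a \<Rightarrow> 'a tvec set" where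
  "horizontal M \<phi> p = \<phi> p ` tangent_space M p"

definition vertical ::
    "('a, 'e::euclidean_space) manifold \<Rightarrow> ('a \<Rightarrow> 'a tvec \<Rightarrow> 'a tvec) \<Rightarrow> 'a \<Rightarrow> 'a tvec set" where
  "vertical M \<phi> p = {u \<in> tangent_space M p. \<phi> p u = 0}"

definition fund_form ::
    "('a \<Rightarrow> 'a tvec \<Rightarrow> 'a tvec \<Rightarrow> real) \<Rightarrow> ('a \<Rightarrow> 'a tvec \<Rightarrow> 'a tvec) \<Rightarrow>
     'a \<Rightarrow> 'a tvec \<Rightarrow> 'a tvec \<Rightarrow> real" where
  "fund_form g \<phi> p u v = g p u (\<phi> p v)"

definition nijenhuis ::
    "('a \<Rightarrow> 'a tvec \<Rightarrow> 'a tvec) \<Rightarrow> 'a field \<Rightarrow> 'a field \<Rightarrow> 'a field" where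
  "nijenhuis \<phi> X Y p =
     (let \<phi>X = (\<lambda>q. \<phi> q (X q)); \<phi>Y = (\<lambda>q. \<phi> q (Y q)) in
      lie_bracket \<phi>X \<phi>Y p + \<phi> p (\<phi> p (lie_bracket X Y p))
      - \<phi> p (lie_bracket X \<phi>Y p) - \<phi> p (lie_bracket \<phi>X Y p))"

definition N1 ::
    "nat \<Rightarrow> ('a \<Rightarrow> 'a tvec \<Rightarrow> 'a tvec) \<Rightarrow> (nat \<Rightarrow> 'a field) \<Rightarrow>
     (nat \<Rightarrow> 'a \<Rightarrow> 'a tvec \<Rightarrow> real) \<Rightarrow> 'a field \<Rightarrow> 'a field \<Rightarrow> 'a field" where
  "N1 s \<phi> \<xi> \<eta> X Y p = nijenhuis \<phi> X Y p + (\<Sum>i=1..s. ext_d (\<eta> i) X Y p *\<^sub>R \<xi> i p)"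

definition S_manifold ::
    "('a, 'e::euclidean_space) manifold \<Rightarrow> nat \<Rightarrow> nat \<Rightarrow> ('a \<Rightarrow> 'a tvec \<Rightarrow> 'a tvec) \<Rightarrow>
     (nat \<Rightarrow> 'a field) \<Rightarrow> (nat \<Rightarrow> 'a \<Rightarrow> 'a tvec \<Rightarrow> real) \<Rightarrow>
     ('a \<Rightarrow> 'a tvec \<Rightarrow> 'a tvec \<Rightarrow> real) \<Rightarrow> bool" where
  "S_manifold M n s \<phi> \<xi> \<eta> g \<longleftrightarrow>
     metric_f_manifold M n s \<phi> \<xi> \<eta> g \<and>
     (\<forall>X\<in>vector_fields M. \<forall>Y\<in>vector_fields M. \<forall>p\<in>pts M.
        N1 s \<phi> \<xi> \<eta> X Y p = 0 \<and>
        (\<forall>i\<in>{1..s}. 2 * fund_form g \<phi> p (X p) (Y p) = ext_d (\<eta> i) X Y p))"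


section \<open>Connections with skew-torsion\<close>

definition affine_connection ::
    "('a, 'e::euclidean_space) manifold \<Rightarrow> ('a field \<Rightarrow> 'a field \<Rightarrow> 'a field) \<Rightarrow> bool" where
  "affine_connection M cov \<longleftrightarrow>
     (\<forall>X\<in>vector_fields M. \<forall>Y\<in>vector_fields M. cov X Y \<in> vector_fields M \<and>
       (\<forall>Z\<in>vector_fields M. \<forall>p\<in>pts M.
          cov (\<lambda>q. X q + Z q) Y p = cov X Y p + cov Z Y p \<and>
          cov X (\<lambda>q. Y q + Z q) p = cov X Y p + cov X Z p) \<and>
       (\<forall>f\<in>smooth_funs M. \<forall>p\<in>pts M.
          cov (\<lambda>q. f q *\<^sub>R X q) Y p = f p *\<^sub>R cov X Y p \<and>
          cov X (\<lambda>q. f q *\<^sub>R Y q) p = X p f *\<^sub>R Y p + f p *\<^sub>R cov X Y p))"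

definition almost_metric_phi_connection ::
    "('a, 'e::euclidean_space) manifold \<Rightarrow> nat \<Rightarrow> ('a \<Rightarrow> 'a tvec \<Rightarrow> 'a tvec) \<Rightarrow>
     (nat \<Rightarrow> 'a field) \<Rightarrow> (nat \<Rightarrow> 'a \<Rightarrow> 'a tvec \<Rightarrow> real) \<Rightarrow>
     ('a \<Rightarrow> 'a tvec \<Rightarrow> 'a tvec \<Rightarrow> real) \<Rightarrow> ('a field \<Rightarrow> 'a field \<Rightarrow> 'a field) \<Rightarrow> bool" where
  "almost_metric_phi_connection M s \<phi> \<xi> \<eta> g cov \<longleftrightarrow>
     affine_connection M cov \<and>
     (\<forall>X\<in>vector_fields M. \<forall>Y\<in>vector_fields M. \<forall>p\<in>pts M.
        (\<forall>Z\<in>vector_fields M.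
           X p (\<lambda>q. g q (Y q) (Z q)) = g p (cov X Y p) (Z p) + g p (Y p) (cov X Z p)) \<and>
        cov X (\<lambda>q. \<phi> q (Y q)) p = \<phi> p (cov X Y p) \<and>
        (\<forall>i\<in>{1..s}. cov X (\<xi> i) p = 0 \<and>
           X p (\<lambda>q. \<eta> i q (Y q)) = \<eta> i p (cov X Y p)))"

definition torsion ::
    "('a field \<Rightarrow> 'a field \<Rightarrow> 'a field) \<Rightarrow> 'a field \<Rightarrow> 'a field \<Rightarrow> 'a field" where
  "torsion cov X Y p = cov X Y p - cov Y X p - lie_bracket X Y p"

text \<open>The connection has skew-torsion, and \<open>T\<close> is its torsion 3-form.\<close>

definition skew_torsion ::
    "('a, 'e::euclidean_space) manifold \<Rightarrow> ('a \<Rightarrow> 'a tvec \<Rightarrow> 'a tvec \<Rightarrow> real) \<Rightarrow>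
     ('a field \<Rightarrow> 'a field \<Rightarrow> 'a field) \<Rightarrow>
     ('a \<Rightarrow> 'a tvec \<Rightarrow> 'a tvec \<Rightarrow> 'a tvec \<Rightarrow> real) \<Rightarrow> bool" where
  "skew_torsion M g cov T \<longleftrightarrow> three_form M T \<and>
     (\<forall>X\<in>vector_fields M. \<forall>Y\<in>vector_fields M. \<forall>Z\<in>vector_fields M. \<forall>p\<in>pts M.
        T p (X p) (Y p) (Z p) = g p (torsion cov X Y p) (Z p))"

definition ker_form ::
    "('a, 'e::euclidean_space) manifold \<Rightarrow> ('a \<Rightarrow> 'a tvec \<Rightarrow> 'a tvec \<Rightarrow> 'a tvec \<Rightarrow> real) \<Rightarrow>
     'a \<Rightarrow> 'a tvec set" where
  "ker_form M T p =
     {u \<in> tangent_space M p. \<forall>v\<in>tangent_space M p. \<forall>w\<in>tangent_space M p. T p u v w = 0}"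


section \<open>Smooth subbundles\<close>

text \<open>Families of subspaces of the tangent spaces are given by their fibres. A smooth frame over \<open>W\<close> is
  the same thing as a smooth trivialization over \<open>W\<close>.\<close>

definition smooth_frame ::
    "('a, 'e::euclidean_space) manifold \<Rightarrow> 'a set \<Rightarrow> ('a \<Rightarrow> 'a tvec set) \<Rightarrow> nat \<Rightarrow>
     (nat \<Rightarrow> 'a field) \<Rightarrow> bool" where
  "smooth_frame M W B k e \<longleftrightarrow>
     (\<forall>i<k. e i \<in> vector_fields_on M W) \<and> (\<forall>p\<in>W. is_basis k (\<lambda>i. e i p) (B p))"

text \<open>\<open>E\<close> is a rank \<open>k\<close> subbundle of the vector bundle \<open>B\<close> of rank \<open>m\<close>: locally there are
  trivializations of \<open>B\<close> that map \<open>E\<close> onto the product of the base with the span of the first \<open>k\<close>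
  coordinate vectors.\<close>

definition smooth_subbundle ::
    "('a, 'e::euclidean_space) manifold \<Rightarrow> ('a \<Rightarrow> 'a tvec set) \<Rightarrow> nat \<Rightarrow>
     ('a \<Rightarrow> 'a tvec set) \<Rightarrow> nat \<Rightarrow> bool" where
  "smooth_subbundle M B m E k \<longleftrightarrow> k \<le> m \<and>
     (\<forall>p\<in>pts M. \<exists>W e. openin (mtop M) W \<and> p \<in> W \<and>
        smooth_frame M W B m e \<and> smooth_frame M W E k e)"

end

theory Submission
  imports Defs
begin

text \<open>The statement is pointwise linear algebra, followed by one observation on smoothness.

  In the tangent space at a point, compatibility of the metric with \<open>\<phi>\<close> gives \<open>g(u, \<xi>\<^sub>j) = \<eta>\<^sub>j(u)\<close>, so
  that pairing with \<open>\<xi>\<^sub>1 + \<dots> + \<xi>\<^sub>s\<close> is the functional \<open>\<eta>\<^sub>1 + \<dots> + \<eta>\<^sub>s\<close>, and every vertical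
  vector is \<open>\<Sum>\<^sub>j \<eta>\<^sub>j(u) \<xi>\<^sub>j\<close>. Put \<open>F(u, v) = g(u, \<phi> v)\<close>. Since \<open>F\<close> vanishes as soon as one argument is
  vertical, contracting \<open>T = 2 \<eta> \<and> F\<close>, where \<open>\<eta>\<close> is the sum of the \<open>\<eta>\<^sub>j\<close>, with \<open>\<xi>\<^sub>1\<close> in the last slot leaves
  \<open>2 F\<close>. Hence a vector in the kernel of \<open>T\<close> is in the kernel of \<open>F\<close>; taking \<open>v = \<phi> u\<close> in \<open>F(u, v)\<close>
  gives \<open>-\<bar>\<phi> u\<bar>\<^sup>2\<close>, so the vector is vertical. On a vertical \<open>u\<close> only the term
  \<open>\<eta>(u) F\<close> of \<open>T(u, \<cdot>, \<cdot>)\<close> survives, and \<open>F\<close> is not zero because the rank of \<open>\<phi>\<close> is positive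
  (lemma \<open>kernel_wedge\<close>). Horizontal kernel vectors are then both horizontal and vertical, so they vanish.

  For the remaining claims, the fields \<open>\<xi>\<^sub>1 - \<xi>\<^sub>s, \<dots>, \<xi>\<^sub>s\<^sub>-\<^sub>1 - \<xi>\<^sub>s, \<xi>\<^sub>s\<close> are a frame of the vertical
  bundle whose dual coframe is \<open>\<eta>\<^sub>1, \<dots>, \<eta>\<^sub>s\<^sub>-\<^sub>1, \<eta>\<close>. The kernel is cut out by the vanishing of the last
  coordinate, so it has the first \<open>s - 1\<close> of these fields as a frame
  (lemmas \<open>vertical_dual_basis\<close> and \<open>kernel_dual_basis\<close>). The frame is global and smooth.\<close>


section \<open>Bases with dual functionals\<close>

lemma linear_map_on_0:
  assumes "linear_map_on V L" "subspace V"
  shows "L 0 = 0"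
proof -
  have "L (0 *\<^sub>R 0) = 0 *\<^sub>R L 0"
    using assms subspace_0 unfolding linear_map_on_def by blast
  then show ?thesis by simp
qed

lemma linear_map_on_diff:
  assumes L: "linear_map_on V L" and V: "subspace V" and u: "u \<in> V" and v: "v \<in> V"
  shows "L (u - v) = L u - L v"
proof -
  have "L (u + (-1) *\<^sub>R v) = L u + L ((-1) *\<^sub>R v)"
    using L u subspace_scale[OF V v] unfolding linear_map_on_def by blast
  also have "L ((-1) *\<^sub>R v) = (-1) *\<^sub>R L v"
    using L v unfolding linear_map_on_def by blast
  finally show ?thesis by simp
qed

lemma linear_map_on_lincomb:
  assumes L: "linear_map_on V L" and V: "subspace V" and e: "\<And>i. i \<in> I \<Longrightarrow> e i \<in> V"
  shows "L (\<Sum>i\<in>I. c i *\<^sub>R e i) = (\<Sum>i\<in>I. c i *\<^sub>R L (e i))"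
  using e
proof (induction I rule: infinite_finite_induct)
  case (insert i I)
  have ei: "e i \<in> V" and sI: "(\<Sum>i\<in>I. c i *\<^sub>R e i) \<in> V"
    using insert.prems by (auto intro!: subspace_sum[OF V] subspace_scale[OF V])
  have "L (c i *\<^sub>R e i + (\<Sum>i\<in>I. c i *\<^sub>R e i)) = L (c i *\<^sub>R e i) + L (\<Sum>i\<in>I. c i *\<^sub>R e i)"
    using L subspace_scale[OF V ei] sI unfolding linear_map_on_def by blast
  moreover have "L (c i *\<^sub>R e i) = c i *\<^sub>R L (e i)"
    using L ei unfolding linear_map_on_def by blast
  ultimately show ?case using insert by simp
qed (simp_all add: linear_map_on_0[OF L V])

lemma linear_map_on_sum_maps:
  assumes "\<And>i. i \<in> I \<Longrightarrow> linear_map_on V (L i)"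
  shows "linear_map_on V (\<lambda>v. \<Sum>i\<in>I. L i v)"
  using assms unfolding linear_map_on_def by (simp add: sum.distrib scaleR_sum_right)

text \<open>The tangent spaces are linear subspaces of a space of functionals that has infinite dimension,
  so counting dimensions is awkward there; exhibiting the coordinate functionals settles independence,
  spanning and the isomorphism with the coordinate space all at once.\<close>

definition dual_basis_on ::
    "nat \<Rightarrow> (nat \<Rightarrow> 'v::real_vector) \<Rightarrow> (nat \<Rightarrow> 'v \<Rightarrow> real) \<Rightarrow> 'v set \<Rightarrow> bool" where
  "dual_basis_on k e \<alpha> V \<longleftrightarrow> subspace V \<and>
     (\<forall>i<k. e i \<in> V \<and> linear_map_on V (\<alpha> i)) \<and>
     (\<forall>i<k. \<forall>j<k. \<alpha> i (e j) = (if i = j then 1 else 0)) \<and>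
     (\<forall>v\<in>V. v = (\<Sum>i<k. \<alpha> i v *\<^sub>R e i))"

lemma dual_basis_on_coordinate:
  assumes "dual_basis_on k e \<alpha> V" "j < k"
  shows "\<alpha> j (\<Sum>i<k. c i *\<^sub>R e i) = c j"
proof -
  have "\<alpha> j (\<Sum>i<k. c i *\<^sub>R e i) = (\<Sum>i<k. c i *\<^sub>R \<alpha> j (e i))"
    using assms by (intro linear_map_on_lincomb[where V = V]) (auto simp: dual_basis_on_def)
  also have "\<dots> = (\<Sum>i<k. if i = j then c i else 0)"
    using assms by (intro sum.cong) (auto simp: dual_basis_on_def)
  also have "\<dots> = c j" using assms(2) by simp
  finally show ?thesis .
qed

lemma dual_basis_on_is_basis:
  assumes b: "dual_basis_on k e \<alpha> V"
  shows "is_basis k e V"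
proof -
  have V: "subspace V" and eV: "e ` {..<k} \<subseteq> V"
    using b by (auto simp: dual_basis_on_def)
  have inj: "inj_on e {..<k}"
  proof (rule inj_onI)
    fix i j assume "i \<in> {..<k}" "j \<in> {..<k}" "e i = e j"
    with b show "i = j"
      unfolding dual_basis_on_def by (metis lessThan_iff zero_neq_one)
  qed
  have "independent (e ` {..<k})"
  proof (rule independent_if_scalars_zero)
    fix f x assume *: "(\<Sum>x\<in>e ` {..<k}. f x *\<^sub>R x) = 0" and "x \<in> e ` {..<k}"
    then obtain j where j: "j < k" "x = e j" by auto
    have "(\<Sum>i<k. f (e i) *\<^sub>R e i) = 0"
      using * by (simp add: sum.reindex[OF inj])
    then have "\<alpha> j 0 = f (e j)"
      using dual_basis_on_coordinate[OF b j(1), of "\<lambda>i. f (e i)"] by simp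
    moreover have "\<alpha> j 0 = 0"
      using b j(1) by (intro linear_map_on_0[OF _ V]) (simp add: dual_basis_on_def)
    ultimately show "f x = 0" using j(2) by simp
  qed simp
  moreover have "span (e ` {..<k}) = V"
  proof
    show "span (e ` {..<k}) \<subseteq> V" by (rule span_minimal[OF eV V])
    show "V \<subseteq> span (e ` {..<k})"
    proof
      fix v assume "v \<in> V"
      then have "v = (\<Sum>i<k. \<alpha> i v *\<^sub>R e i)" using b by (simp add: dual_basis_on_def)
      also have "\<dots> \<in> span (e ` {..<k})"
        by (intro span_sum span_scale span_base) auto
      finally show "v \<in> span (e ` {..<k})" .
    qed
  qed
  ultimately show ?thesis using inj by (simp add: is_basis_def)
qed

lemma subspace_Rn: "subspace (Rn k)"
  unfolding subspace_def Rn_def by (auto simp: scaleR_fun_def)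

lemma dual_basis_on_isomorphic_Rn:
  assumes b: "dual_basis_on k e \<alpha> V"
  shows "linear_isomorphic V (Rn k)"
proof -
  define L where "L v = (\<lambda>i. if i < k then \<alpha> i v else 0)" for v
  have V: "subspace V" and eV: "\<And>i. i < k \<Longrightarrow> e i \<in> V"
    using b by (auto simp: dual_basis_on_def)
  have expand: "v = (\<Sum>i<k. L v i *\<^sub>R e i)" if "v \<in> V" for v
    using b that by (simp add: dual_basis_on_def L_def)
  have "linear_map_on V L"
    using b unfolding linear_map_on_def dual_basis_on_def L_def
    by (auto simp: fun_eq_iff scaleR_fun_def)
  moreover have "bij_betw L V (Rn k)"
  proof (rule bij_betw_imageI)
    show "inj_on L V" by (rule inj_onI) (metis expand)
    show "L ` V = Rn k"
    proof
      show "L ` V \<subseteq> Rn k" by (auto simp: L_def Rn_def)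
      show "Rn k \<subseteq> L ` V"
      proof
        fix c assume c: "c \<in> Rn k"
        have "L (\<Sum>i<k. c i *\<^sub>R e i) = c"
          using c by (auto simp: fun_eq_iff L_def Rn_def dual_basis_on_coordinate[OF b])
        moreover have "(\<Sum>i<k. c i *\<^sub>R e i) \<in> V"
          by (intro subspace_sum[OF V] subspace_scale[OF V] eV) simp
        ultimately show "c \<in> L ` V" by (metis imageI)
      qed
    qed
  qed
  ultimately show ?thesis using V subspace_Rn by (auto simp: linear_isomorphic_def)
qed


section \<open>A single tangent space\<close>

text \<open>Fixing the point turns the fields of a metric f-manifold into linear maps and vectors on one vector
  space, which is all that the kernel of \<open>T\<close> at that point depends on; \<open>metric_f_space_tangent\<close> makes
  the passage.\<close>

locale metric_f_space =
  fixes V :: "'v::real_vector set" and s :: nat and \<phi> :: "'v \<Rightarrow> 'v" and \<xi> :: "nat \<Rightarrow> 'v"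
    and \<eta> :: "nat \<Rightarrow> 'v \<Rightarrow> real" and g :: "'v \<Rightarrow> 'v \<Rightarrow> real"
  assumes V: "subspace V"
    and phi_in: "u \<in> V \<Longrightarrow> \<phi> u \<in> V"
    and phi_lin: "linear_map_on V \<phi>"
    and g_lin: "u \<in> V \<Longrightarrow> linear_map_on V (g u)"
    and g_sym: "u \<in> V \<Longrightarrow> v \<in> V \<Longrightarrow> g u v = g v u"
    and g_pos: "u \<in> V \<Longrightarrow> u \<noteq> 0 \<Longrightarrow> g u u > 0"
    and xi_in: "i \<in> {1..s} \<Longrightarrow> \<xi> i \<in> V"
    and eta_lin: "i \<in> {1..s} \<Longrightarrow> linear_map_on V (\<eta> i)"
    and phi_xi: "i \<in> {1..s} \<Longrightarrow> \<phi> (\<xi> i) = 0"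
    and eta_xi: "i \<in> {1..s} \<Longrightarrow> j \<in> {1..s} \<Longrightarrow> \<eta> i (\<xi> j) = (if i = j then 1 else 0)"
    and eta_phi: "u \<in> V \<Longrightarrow> i \<in> {1..s} \<Longrightarrow> \<eta> i (\<phi> u) = 0"
    and phi_phi: "u \<in> V \<Longrightarrow> \<phi> (\<phi> u) = - u + (\<Sum>i=1..s. \<eta> i u *\<^sub>R \<xi> i)"
    and g_phi: "u \<in> V \<Longrightarrow> v \<in> V \<Longrightarrow> g (\<phi> u) (\<phi> v) = g u v - (\<Sum>i=1..s. \<eta> i u * \<eta> i v)"
begin

definition eta_bar :: "'v \<Rightarrow> real" where
  "eta_bar = (\<lambda>u. \<Sum>i=1..s. \<eta> i u)"

abbreviation F :: "'v \<Rightarrow> 'v \<Rightarrow> real" where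
  "F u v \<equiv> g u (\<phi> v)"

lemma eta_bar_lin: "linear_map_on V eta_bar"
  unfolding eta_bar_def by (rule linear_map_on_sum_maps) (rule eta_lin)

lemma eta_bar_xi: "j \<in> {1..s} \<Longrightarrow> eta_bar (\<xi> j) = 1"
  unfolding eta_bar_def by (subst sum.cong[OF refl eta_xi]) auto

lemma g_xi:
  assumes "u \<in> V" "j \<in> {1..s}"
  shows "g u (\<xi> j) = \<eta> j u"
proof -
  have "g (\<phi> u) (\<phi> (\<xi> j)) = 0"
    using linear_map_on_0[OF g_lin V] phi_in assms by (simp add: phi_xi)
  moreover have "(\<Sum>i=1..s. \<eta> i u * \<eta> i (\<xi> j)) = (\<Sum>i=1..s. if i = j then \<eta> i u else 0)"
    using assms by (intro sum.cong) (auto simp: eta_xi)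
  ultimately show ?thesis
    using g_phi[OF assms(1) xi_in[OF assms(2)]] assms(2) by simp
qed

lemma g_xi_sum:
  assumes "u \<in> V"
  shows "g u (\<Sum>j=1..s. \<xi> j) = eta_bar u"
proof -
  have "g u (\<Sum>j=1..s. 1 *\<^sub>R \<xi> j) = (\<Sum>j=1..s. 1 *\<^sub>R g u (\<xi> j))"
    by (rule linear_map_on_lincomb[OF g_lin[OF assms] V xi_in])
  also have "\<dots> = eta_bar u"
    unfolding eta_bar_def using assms by (intro sum.cong) (auto simp: g_xi)
  finally show ?thesis by simp
qed

lemma vertical_expand:
  assumes "u \<in> V" "\<phi> u = 0"
  shows "u = (\<Sum>i=1..s. \<eta> i u *\<^sub>R \<xi> i)"
  using phi_phi[OF assms(1)] assms(2) linear_map_on_0[OF phi_lin V] by simp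

text \<open>\<open>\<phi>\<close> is skew-adjoint, tested on vectors in its image. Both sides expand to
  \<open>\<Sum>\<^sub>i \<eta>\<^sub>i(u) \<eta>\<^sub>i(v) - g(u, v)\<close>, and for \<open>u = v\<close> the right one is minus a squared length.\<close>

lemma F_phi:
  assumes u: "u \<in> V" and v: "v \<in> V"
  shows "F u (\<phi> v) = - g (\<phi> u) (\<phi> v)"
proof -
  have S: "(\<Sum>i=1..s. \<eta> i v *\<^sub>R \<xi> i) \<in> V"
    by (intro subspace_sum[OF V] subspace_scale[OF V] xi_in)
  have "g u (\<phi> (\<phi> v)) = g u ((\<Sum>i=1..s. \<eta> i v *\<^sub>R \<xi> i) - v)"
    by (simp add: phi_phi[OF v])
  also have "\<dots> = g u (\<Sum>i=1..s. \<eta> i v *\<^sub>R \<xi> i) - g u v"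
    by (rule linear_map_on_diff[OF g_lin[OF u] V S v])
  also have "g u (\<Sum>i=1..s. \<eta> i v *\<^sub>R \<xi> i) = (\<Sum>i=1..s. \<eta> i v *\<^sub>R g u (\<xi> i))"
    by (rule linear_map_on_lincomb[OF g_lin[OF u] V xi_in])
  also have "\<dots> = (\<Sum>i=1..s. \<eta> i u * \<eta> i v)"
    using u by (intro sum.cong) (auto simp: g_xi)
  finally show ?thesis using g_phi[OF u v] by simp
qed

lemma F_vertical_right: "u \<in> V \<Longrightarrow> \<phi> v = 0 \<Longrightarrow> F u v = 0"
  using linear_map_on_0[OF g_lin V] by simp

lemma F_vertical_left:
  assumes u: "u \<in> V" "\<phi> u = 0" and v: "v \<in> V"
  shows "F u v = 0"
proof -
  have "g (\<phi> v) u = g (\<phi> v) (\<Sum>i=1..s. \<eta> i u *\<^sub>R \<xi> i)"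
    using vertical_expand[OF u] by simp
  also have "\<dots> = (\<Sum>i=1..s. \<eta> i u *\<^sub>R g (\<phi> v) (\<xi> i))"
    by (rule linear_map_on_lincomb[OF g_lin[OF phi_in[OF v]] V xi_in])
  also have "\<dots> = 0"
    using v by (intro sum.neutral) (auto simp: g_xi phi_in eta_phi)
  finally show ?thesis using u v by (simp add: g_sym phi_in)
qed

lemma horizontal_vertical_0:
  assumes "u \<in> V" "\<phi> (\<phi> u) = 0"
  shows "\<phi> u = 0"
  using vertical_expand[OF phi_in assms(2)] assms(1) by (simp add: eta_phi)

text \<open>A kernel vector is first shown to be vertical by contracting with \<open>\<xi>\<^sub>1\<close>, which needs \<open>s\<close> to be
  positive; a \<open>v\<close> outside the kernel of \<open>\<phi>\<close> then detects the value of \<open>eta_bar\<close>, as \<open>F (\<phi> v) v\<close> is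
  the squared length of \<open>\<phi> v\<close>.\<close>

lemma kernel_wedge:
  assumes s: "s \<ge> 1" and nz: "\<exists>v\<in>V. \<phi> v \<noteq> 0" and u: "u \<in> V"
  shows "(\<forall>v\<in>V. \<forall>w\<in>V. wedge12 eta_bar F u v w = 0) \<longleftrightarrow> \<phi> u = 0 \<and> eta_bar u = 0"
proof
  assume ker: "\<forall>v\<in>V. \<forall>w\<in>V. wedge12 eta_bar F u v w = 0"
  have xi1: "\<xi> 1 \<in> V" "\<phi> (\<xi> 1) = 0" "eta_bar (\<xi> 1) = 1"
    using s xi_in[of 1] phi_xi[of 1] eta_bar_xi[of 1] by simp_all
  have "F u v = 0" if v: "v \<in> V" for v
  proof -
    have "wedge12 eta_bar F u v (\<xi> 1) = 0" using ker v xi1(1) by blast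
    moreover have "F v (\<xi> 1) = 0" by (rule F_vertical_right[OF v xi1(2)])
    moreover have "F (\<xi> 1) u = 0" by (rule F_vertical_left[OF xi1(1,2) u])
    ultimately show ?thesis using xi1(3) by (simp add: wedge12_def)
  qed
  then have "g (\<phi> u) (\<phi> u) = 0" using F_phi[OF u u] phi_in[OF u] by simp
  then have phi_u: "\<phi> u = 0" using g_pos[OF phi_in[OF u]] by force
  from nz obtain v where v: "v \<in> V" "\<phi> v \<noteq> 0" by blast
  have "wedge12 eta_bar F u (\<phi> v) v = 0" using ker v(1) phi_in by blast
  then have "eta_bar u * F (\<phi> v) v = 0"
    by (simp add: wedge12_def F_vertical_left[OF u phi_u phi_in[OF v(1)]]
        F_vertical_right[OF v(1) phi_u])
  moreover have "F (\<phi> v) v > 0" using g_pos[OF phi_in[OF v(1)] v(2)] .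
  ultimately show "\<phi> u = 0 \<and> eta_bar u = 0" using phi_u by simp
next
  assume "\<phi> u = 0 \<and> eta_bar u = 0"
  then have *: "\<phi> u = 0" "eta_bar u = 0" by auto
  show "\<forall>v\<in>V. \<forall>w\<in>V. wedge12 eta_bar F u v w = 0"
    unfolding wedge12_def
    by (simp add: *(2) F_vertical_left[OF u *(1)] F_vertical_right[OF _ *(1)])
qed

text \<open>Bases are numbered from \<open>0\<close> and the \<open>\<xi>\<close> from \<open>1\<close>, whence the index shift. Subtracting \<open>\<xi> s\<close> puts
  all vectors but the last into the kernel of \<open>eta_bar\<close>, which becomes the last dual functional.\<close>

definition frame :: "nat \<Rightarrow> 'v" where
  "frame i = (if Suc i < s then \<xi> (Suc i) - \<xi> s else \<xi> (Suc i))"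

definition coframe :: "nat \<Rightarrow> 'v \<Rightarrow> real" where
  "coframe i = (if Suc i < s then \<eta> (Suc i) else eta_bar)"

lemma frame_in: "i < s \<Longrightarrow> frame i \<in> V"
  unfolding frame_def by (auto intro!: xi_in subspace_diff[OF V])

lemma phi_frame: "i < s \<Longrightarrow> \<phi> (frame i) = 0"
  unfolding frame_def by (auto simp: xi_in phi_xi linear_map_on_diff[OF phi_lin V])

lemma coframe_lin: "i < s \<Longrightarrow> linear_map_on V (coframe i)"
  unfolding coframe_def using eta_lin eta_bar_lin by auto

lemma coframe_frame:
  assumes "i < s" "j < s"
  shows "coframe i (frame j) = (if i = j then 1 else 0)"
proof (cases "Suc i < s")
  case True
  then show ?thesis
    using assms
    by (auto simp: coframe_def frame_def xi_in eta_xi linear_map_on_diff[OF eta_lin V])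
next
  case False
  then have i: "Suc i = s" using assms by simp
  have xi: "eta_bar (\<xi> (Suc j)) = 1" "eta_bar (\<xi> s) = 1" "\<xi> (Suc j) \<in> V" "\<xi> s \<in> V"
    using assms by (auto intro!: eta_bar_xi xi_in)
  have "eta_bar (\<xi> (Suc j) - \<xi> s) = 0"
    using linear_map_on_diff[OF eta_bar_lin V xi(3,4)] xi(1,2) by simp
  then show ?thesis
    using i xi assms unfolding coframe_def frame_def by auto
qed

lemma frame_expand:
  assumes s: "s \<ge> 1" and u: "u \<in> V" "\<phi> u = 0"
  shows "u = (\<Sum>i<s. coframe i u *\<^sub>R frame i)"
proof -
  obtain m where m: "s = Suc m" using s by (cases s) auto
  have last: "coframe m = eta_bar" "frame m = \<xi> s"
    unfolding coframe_def frame_def using m by auto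
  have shift: "(\<Sum>i=1..s. h i) = (\<Sum>i<m. h (Suc i)) + h s" for h :: "nat \<Rightarrow> 'b::comm_monoid_add"
    using m by (simp add: sum.atLeast1_atMost_eq)
  have below: "coframe i = \<eta> (Suc i)" "frame i = \<xi> (Suc i) - \<xi> s" if "i < m" for i
    unfolding coframe_def frame_def using m that by auto
  have split_last: "(\<Sum>i<s. h i) = (\<Sum>i<m. h i) + h m" for h :: "nat \<Rightarrow> 'v"
    by (simp add: m)
  have "(\<Sum>i<s. coframe i u *\<^sub>R frame i)
      = (\<Sum>i<m. \<eta> (Suc i) u *\<^sub>R (\<xi> (Suc i) - \<xi> s)) + eta_bar u *\<^sub>R \<xi> s"
    unfolding split_last last
    by (intro arg_cong2[of _ _ _ _ "(+)"] sum.cong) (auto simp: below)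
  also have "\<dots> = (\<Sum>i<m. \<eta> (Suc i) u *\<^sub>R \<xi> (Suc i)) + \<eta> s u *\<^sub>R \<xi> s"
    unfolding eta_bar_def shift
    by (simp add: scaleR_diff_right sum_subtractf scaleR_add_left scaleR_sum_left)
  also have "\<dots> = u"
    using vertical_expand[OF u] shift[of "\<lambda>i. \<eta> i u *\<^sub>R \<xi> i"] by simp
  finally show ?thesis by simp
qed

lemma subspace_vertical: "subspace {u \<in> V. \<phi> u = 0}"
  using V phi_lin linear_map_on_0[OF phi_lin V]
  unfolding subspace_def linear_map_on_def by auto

lemma vertical_dual_basis:
  assumes "s \<ge> 1"
  shows "dual_basis_on s frame coframe {u \<in> V. \<phi> u = 0}"
  unfolding dual_basis_on_def
  using subspace_vertical frame_in phi_frame coframe_lin coframe_frame frame_expand[OF assms]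
  by (auto simp: linear_map_on_def)

lemma kernel_dual_basis:
  assumes s: "s \<ge> 1"
  shows "dual_basis_on (s - 1) frame coframe {u \<in> V. \<phi> u = 0 \<and> eta_bar u = 0}"
proof -
  obtain m where m: "s = Suc m" using s by (cases s) auto
  have last: "coframe m = eta_bar" unfolding coframe_def using m by auto
  have "subspace {u \<in> V. \<phi> u = 0 \<and> eta_bar u = 0}"
    using subspace_vertical eta_bar_lin linear_map_on_0[OF eta_bar_lin V]
    unfolding subspace_def linear_map_on_def by auto
  moreover have "eta_bar (frame i) = 0" if "i < m" for i
    using coframe_frame[of m i] that m last by simp
  moreover have "u = (\<Sum>i<m. coframe i u *\<^sub>R frame i)"
    if "u \<in> V" "\<phi> u = 0" "eta_bar u = 0" for u
    using frame_expand[OF s that(1,2)] last that(3)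
    by (simp only: m sum.lessThan_Suc) simp
  moreover have "linear_map_on {u \<in> V. \<phi> u = 0 \<and> eta_bar u = 0} (coframe i)" if "i < m" for i
    using coframe_lin[of i] that m unfolding linear_map_on_def by auto
  ultimately show ?thesis
    unfolding dual_basis_on_def
    using frame_in phi_frame coframe_frame m by simp
qed

end


section \<open>Tangent spaces and smooth vector fields\<close>

lemma subspace_tangent_space: "subspace (tangent_space M p)"
  unfolding subspace_def tangent_space_def
  by (auto simp: scaleR_fun_def algebra_simps)

text \<open>Openness is essential: the derivative at a boundary point would also see values of the functions
  outside \<open>S\<close>.\<close>

lemma Ck_on_cong:
  assumes S: "open S" and eq: "\<And>x. x \<in> S \<Longrightarrow> f x = h x" and f: "Ck_on k S f"
  shows "Ck_on k S h"
  using eq f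
proof (induction k arbitrary: f h)
  case 0
  then show ?case using continuous_on_cong[of S S f h] by simp
next
  case (Suc k)
  have D: "(h has_derivative frechet_derivative f (at x)) (at x)" if x: "x \<in> S" for x
  proof (rule has_derivative_transform_within_open[OF _ S x])
    show "(f has_derivative frechet_derivative f (at x)) (at x)"
      using Suc.prems(2) x frechet_derivative_works by auto
  qed (rule Suc.prems(1))
  have "Ck_on k S (\<lambda>x. frechet_derivative h (at x) v)" for v
  proof (rule Suc.IH)
    show "Ck_on k S (\<lambda>x. frechet_derivative f (at x) v)" using Suc.prems(2) by simp
    show "frechet_derivative f (at x) v = frechet_derivative h (at x) v" if "x \<in> S" for x
      using frechet_derivative_at[OF D[OF that]] by simp
  qed
  then show ?case using D by (auto simp: differentiable_def)
qed

lemma Ck_on_diff: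
  assumes S: "open S" and "Ck_on k S f" "Ck_on k S h"
  shows "Ck_on k S (\<lambda>x. f x - h x)"
  using assms(2,3)
proof (induction k arbitrary: f h)
  case 0
  then show ?case by (auto intro: continuous_on_diff)
next
  case (Suc k)
  have D: "((\<lambda>x. f x - h x) has_derivative
      (\<lambda>v. frechet_derivative f (at x) v - frechet_derivative h (at x) v)) (at x)"
    if "x \<in> S" for x
    using Suc.prems that by (intro has_derivative_diff) (auto simp: frechet_derivative_works)
  have "Ck_on k S (\<lambda>x. frechet_derivative (\<lambda>x. f x - h x) (at x) v)" for v
  proof (rule Ck_on_cong[OF S])
    show "Ck_on k S (\<lambda>x. frechet_derivative f (at x) v - frechet_derivative h (at x) v)"
      using Suc.prems by (intro Suc.IH) auto
    show "frechet_derivative f (at x) v - frechet_derivative h (at x) v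
        = frechet_derivative (\<lambda>x. f x - h x) (at x) v" if "x \<in> S" for x
      using frechet_derivative_at[OF D[OF that]] by metis
  qed
  then show ?case using D by (auto simp: differentiable_def)
qed

lemma smooth_fun_on_diff:
  assumes M: "smooth_manifold M"
    and f: "smooth_fun_on M (pts M) f" and h: "smooth_fun_on M (pts M) h"
  shows "smooth_fun_on M (pts M) (\<lambda>q. f q - h q)"
  unfolding smooth_fun_on_def
proof (intro ballI, clarify)
  fix U \<psi> assume A: "(U, \<psi>) \<in> atlas M"
  then have chart: "is_chart (mtop M) U \<psi>" using M by (auto simp: smooth_manifold_def)
  then have "U \<inter> pts M = U" using openin_subset by (auto simp: is_chart_def)
  then have op: "open (\<psi> ` (U \<inter> pts M))" using chart by (simp add: is_chart_def)
  show "Cinf_on (\<psi> ` (U \<inter> pts M)) ((\<lambda>q. f q - h q) \<circ> inv_into U \<psi>)"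
    unfolding Cinf_on_def
  proof
    fix k
    have "Ck_on k (\<psi> ` (U \<inter> pts M)) (f \<circ> inv_into U \<psi>)"
      and "Ck_on k (\<psi> ` (U \<inter> pts M)) (h \<circ> inv_into U \<psi>)"
      using f h A by (auto simp: smooth_fun_on_def Cinf_on_def)
    from Ck_on_diff[OF op this]
    show "Ck_on k (\<psi> ` (U \<inter> pts M)) ((\<lambda>q. f q - h q) \<circ> inv_into U \<psi>)"
      by (simp add: comp_def)
  qed
qed

lemma vector_fields_diff:
  assumes "smooth_manifold M" "X \<in> vector_fields M" "Y \<in> vector_fields M"
  shows "(\<lambda>p. X p - Y p) \<in> vector_fields M"
  using assms unfolding vector_fields_on_def
  by (auto intro!: subspace_diff[OF subspace_tangent_space] smooth_fun_on_diff)


section \<open>The kernel of the torsion form\<close>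

lemma metric_f_space_tangent:
  assumes mf: "metric_f_manifold M n s \<phi> \<xi> \<eta> g" and p: "p \<in> pts M"
  shows "metric_f_space (tangent_space M p) s (\<phi> p) (\<lambda>i. \<xi> i p) (\<lambda>i. \<eta> i p) (g p)"
proof -
  let ?V = "tangent_space M p"
  have tensors: "tensor11 M \<phi>" "riemannian_metric M g"
    "\<forall>i\<in>{1..s}. \<xi> i \<in> vector_fields M \<and> one_form M (\<eta> i)"
    and pointwise: "{u \<in> ?V. \<phi> p u = 0} = span ((\<lambda>i. \<xi> i p) ` {1..s})"
      "\<forall>i\<in>{1..s}. \<forall>j\<in>{1..s}. \<eta> i p (\<xi> j p) = (if i = j then 1 else 0)"
      "\<forall>u\<in>?V. \<phi> p (\<phi> p (\<phi> p u)) + \<phi> p u = 0 \<and> (\<forall>i\<in>{1..s}. \<eta> i p (\<phi> p u) = 0) \<and>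
         \<phi> p (\<phi> p u) = - u + (\<Sum>i=1..s. \<eta> i p u *\<^sub>R \<xi> i p) \<and>
         (\<forall>v\<in>?V. g p (\<phi> p u) (\<phi> p v) = g p u v - (\<Sum>i=1..s. \<eta> i p u * \<eta> i p v))"
    using mf p unfolding metric_f_manifold_def
    by - (elim conjE, drule (1) bspec, elim conjE, assumption)+
  show ?thesis
  proof
    show "subspace ?V" by (rule subspace_tangent_space)
  next
    fix u assume u: "u \<in> ?V"
    show "\<phi> p u \<in> ?V" using tensors(1) p u unfolding tensor11_def by blast
    show "linear_map_on ?V (g p u)"
      using tensors(2) p u unfolding riemannian_metric_def by blast
    show "\<phi> p (\<phi> p u) = - u + (\<Sum>i=1..s. \<eta> i p u *\<^sub>R \<xi> i p)"
      using bspec[OF pointwise(3) u] by (elim conjE)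
    show "g p u u > 0" if "u \<noteq> 0"
      using tensors(2) p u that unfolding riemannian_metric_def by blast
    show "\<eta> i p (\<phi> p u) = 0" if "i \<in> {1..s}" for i
      using bspec[OF pointwise(3) u] that by (elim conjE) (drule (1) bspec)
    fix v assume v: "v \<in> ?V"
    show "g p u v = g p v u"
      using tensors(2) p u v unfolding riemannian_metric_def by blast
    show "g p (\<phi> p u) (\<phi> p v) = g p u v - (\<Sum>i=1..s. \<eta> i p u * \<eta> i p v)"
      using bspec[OF pointwise(3) u] v by (elim conjE) (drule (1) bspec)
  next
    show "linear_map_on ?V (\<phi> p)" using tensors(1) p unfolding tensor11_def by blast
  next
    fix i assume i: "i \<in> {1..s}"
    show "\<xi> i p \<in> ?V" using tensors(3) p i unfolding vector_fields_on_def by blast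
    show "linear_map_on ?V (\<eta> i p)" using tensors(3) p i unfolding one_form_def by blast
    have "\<xi> i p \<in> span ((\<lambda>i. \<xi> i p) ` {1..s})" using i by (intro span_base) auto
    then show "\<phi> p (\<xi> i p) = 0" unfolding pointwise(1)[symmetric] by simp
    show "\<eta> i p (\<xi> j p) = (if i = j then 1 else 0)" if "j \<in> {1..s}" for j
      using pointwise(2) i that by blast
  qed
qed

lemma phi_nonzero:
  assumes mf: "metric_f_manifold M n s \<phi> \<xi> \<eta> g" and "n \<ge> 1" and p: "p \<in> pts M"
  shows "\<exists>v\<in>tangent_space M p. \<phi> p v \<noteq> 0"
proof (rule ccontr)
  assume "\<not> ?thesis"
  then have "\<phi> p ` tangent_space M p \<subseteq> {0}" by blast
  then have "span (\<phi> p ` tangent_space M p) = span {}"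
    using span_mono[of "\<phi> p ` tangent_space M p" "{0}"] span_0[of "\<phi> p ` tangent_space M p"]
    by auto
  then have "dim (\<phi> p ` tangent_space M p) = card ({} :: 'a tvec set)"
    by (intro dim_eq_card) (auto simp: independent_empty)
  moreover have "dim (\<phi> p ` tangent_space M p) = 2 * n"
    using mf p unfolding metric_f_manifold_def by blast
  ultimately show False using \<open>n \<ge> 1\<close> by simp
qed


theorem proposition4p5:
  fixes M :: "('a, 'e::euclidean_space) manifold" and n s :: nat
    and \<phi> :: "'a \<Rightarrow> 'a tvec \<Rightarrow> 'a tvec"
    and \<xi> :: "nat \<Rightarrow> 'a field"
    and \<eta> :: "nat \<Rightarrow> 'a \<Rightarrow> 'a tvec \<Rightarrow> real"
    and g :: "'a \<Rightarrow> 'a tvec \<Rightarrow> 'a tvec \<Rightarrow> real"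
    and cov :: "'a field \<Rightarrow> 'a field \<Rightarrow> 'a field"
    and T :: "'a \<Rightarrow> 'a tvec \<Rightarrow> 'a tvec \<Rightarrow> 'a tvec \<Rightarrow> real"
  assumes "n \<ge> 1" and "s \<ge> 1"
    and "S_manifold M n s \<phi> \<xi> \<eta> g"
    and "almost_metric_phi_connection M s \<phi> \<xi> \<eta> g cov"
    and "skew_torsion M g cov T"
    and "\<forall>x\<in>pts M. \<forall>u\<in>tangent_space M x. \<forall>v\<in>tangent_space M x. \<forall>w\<in>tangent_space M x.
           T x u v w = 2 * wedge12 (\<lambda>z. \<Sum>i=1..s. \<eta> i x z) (fund_form g \<phi> x) u v w"
  shows "(\<forall>x\<in>pts M. \<forall>U\<in>horizontal M \<phi> x. U \<noteq> 0 \<longrightarrow> U \<notin> ker_form M T x)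
    \<and> (\<forall>x\<in>pts M. ker_form M T x = {V \<in> vertical M \<phi> x. g x V (\<Sum>j=1..s. \<xi> j x) = 0})
    \<and> (\<forall>x\<in>pts M. linear_isomorphic (ker_form M T x) (Rn (s - 1)))
    \<and> smooth_subbundle M (vertical M \<phi>) s (ker_form M T) (s - 1)"
proof -
  have mf: "metric_f_manifold M n s \<phi> \<xi> \<eta> g"
    using assms(3) by (simp add: S_manifold_def)
  have pt: "metric_f_space (tangent_space M x) s (\<phi> x) (\<lambda>i. \<xi> i x) (\<lambda>i. \<eta> i x) (g x)"
    if "x \<in> pts M" for x
    using metric_f_space_tangent[OF mf that] .
  have ker: "ker_form M T x =
      {u \<in> tangent_space M x. \<phi> x u = 0 \<and> (\<Sum>i=1..s. \<eta> i x u) = 0}" if x: "x \<in> pts M" for x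
  proof -
    have "ker_form M T x = {u \<in> tangent_space M x. \<forall>v\<in>tangent_space M x. \<forall>w\<in>tangent_space M x.
        wedge12 (\<lambda>z. \<Sum>i=1..s. \<eta> i x z) (\<lambda>u v. g x u (\<phi> x v)) u v w = 0}"
      using assms(6) x unfolding ker_form_def fund_form_def[abs_def] by auto
    then show ?thesis
      using metric_f_space.kernel_wedge[OF pt[OF x] assms(2) phi_nonzero[OF mf assms(1) x]]
      unfolding metric_f_space.eta_bar_def[OF pt[OF x]] by auto
  qed
  have no_horizontal: "U \<notin> ker_form M T x"
    if x: "x \<in> pts M" and U: "U \<in> horizontal M \<phi> x" "U \<noteq> 0" for x U
    using U metric_f_space.horizontal_vertical_0[OF pt[OF x]] ker[OF x]
    unfolding horizontal_def by auto
  have ker_eq: "ker_form M T x = {V \<in> vertical M \<phi> x. g x V (\<Sum>j=1..s. \<xi> j x) = 0}"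
    if x: "x \<in> pts M" for x
    unfolding ker[OF x] vertical_def
    using metric_f_space.g_xi_sum[OF pt[OF x]] metric_f_space.eta_bar_def[OF pt[OF x]] by auto
  have iso: "linear_isomorphic (ker_form M T x) (Rn (s - 1))" if x: "x \<in> pts M" for x
    using dual_basis_on_isomorphic_Rn[OF metric_f_space.kernel_dual_basis[OF pt[OF x] assms(2)]]
    by (simp only: ker[OF x] metric_f_space.eta_bar_def[OF pt[OF x]])
  have subbundle: "smooth_subbundle M (vertical M \<phi>) s (ker_form M T) (s - 1)"
  proof -
    \<comment> \<open>one family of global fields serves as frame of both bundles, so it can be used
      over all of \<open>M\<close> at every point\<close>
    define e :: "nat \<Rightarrow> 'a field"
      where "e i = (if Suc i < s then (\<lambda>x. \<xi> (Suc i) x - \<xi> s x) else \<xi> (Suc i))" for i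
    have e: "(\<lambda>i. e i x) = metric_f_space.frame s (\<lambda>i. \<xi> i x)" if "x \<in> pts M" for x
      by (simp add: fun_eq_iff e_def metric_f_space.frame_def[OF pt[OF that]])
    have smooth: "e i \<in> vector_fields M" if "i < s" for i
      using mf that assms(2) unfolding e_def metric_f_manifold_def
      by (auto intro!: vector_fields_diff)
    have "is_basis s (\<lambda>i. e i x) (vertical M \<phi> x)" if x: "x \<in> pts M" for x
      unfolding vertical_def e[OF x]
      by (rule dual_basis_on_is_basis[OF metric_f_space.vertical_dual_basis[OF pt[OF x] assms(2)]])
    moreover have "is_basis (s - 1) (\<lambda>i. e i x) (ker_form M T x)" if x: "x \<in> pts M" for x
      using dual_basis_on_is_basis[OF metric_f_space.kernel_dual_basis[OF pt[OF x] assms(2)]]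
      by (simp only: ker[OF x] e[OF x] metric_f_space.eta_bar_def[OF pt[OF x]])
    ultimately have "smooth_frame M (pts M) (vertical M \<phi>) s e"
      and "smooth_frame M (pts M) (ker_form M T) (s - 1) e"
      using smooth by (auto simp: smooth_frame_def)
    then show ?thesis
      unfolding smooth_subbundle_def using openin_topspace[of "mtop M"] by auto
  qed
  show ?thesis
    by (intro conjI ballI impI no_horizontal ker_eq iso subbundle)
qed

end
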